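(* Let $K$ be a convex body in $\mathbb{R}^n$ with centroid at the origin, let $s\ge0$, and let $f:\partial K\to\mathbb{R}$ be a nonnegative, integrable function. Then: (i) $K^{f,s}=\bigcap_{\delta>0}K^{f,s+\delta}$. (ii) $K^{f,s}$ is star convex; that is, for all $x\in K^{f,s}$ one has $[0,x]\subset K^{f,s}$.
   Context: A convex body is a compact convex set with nonempty interior. $\mu_K$ is the surface area measure on $\partial K$ and $\mu_f(A)=\int_A f\,d\mu_K$. $[x,K]$ is the convex hull of $\{x\}\cup K$, and $[0,x]$ is the segment from $0$ to $x$. The illumination surface body is $$K^{f,s}=\{x\in\mathbb{R}^n:\mu_f(\partial K\cap\overline{[x,K]\setminus K})\le s\}.$$ *)

theory Defs
  imports "HOL-Analysis.Analysis"
begin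

section \<open>Hausdorff measure\<close>

text \<open>
  The \<open>d\<close>-dimensional Hausdorff measure, normalised (by the volume of the \<open>d\<close>-dimensional unit
  ball) so that in dimension \<open>d\<close> it is Lebesgue measure. The empty set is treated separately
  because \<open>0 ^ 0 = 1\<close>; with this convention the case \<open>d = 0\<close> is counting measure. Covering sets
  have to be bounded because \<open>diameter\<close> is real valued.
\<close>

definition hausdorff_weight :: "nat \<Rightarrow> 'a::metric_space set \<Rightarrow> ennreal" where
  "hausdorff_weight d C =
     (if C = {} then 0 else ennreal (unit_ball_vol (real d) * (diameter C / 2) ^ d))"

definition hausdorff_covers :: "real \<Rightarrow> 'a::metric_space set \<Rightarrow> (nat \<Rightarrow> 'a set) set" where
  "hausdorff_covers \<delta> A = {C. A \<subseteq> (\<Union>i. C i) \<and> (\<forall>i. bounded (C i) \<and> diameter (C i) \<le> \<delta>)}"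

definition hausdorff_pre :: "nat \<Rightarrow> real \<Rightarrow> 'a::metric_space set \<Rightarrow> ennreal" where
  "hausdorff_pre d \<delta> A = (INF C\<in>hausdorff_covers \<delta> A. \<Sum>i. hausdorff_weight d (C i))"

definition hausdorff_outer :: "nat \<Rightarrow> 'a::metric_space set \<Rightarrow> ennreal" where
  "hausdorff_outer d A = (SUP \<delta>\<in>{0<..}. hausdorff_pre d \<delta> A)"

text \<open>
  The measure lives on the sigma-algebra of all Caratheodory measurable sets, which contains
  the Borel sets (\<open>borel_sets_hausdorff\<close> below).
\<close>

definition hausdorff_measure :: "nat \<Rightarrow> 'a::metric_space measure" where
  "hausdorff_measure d =
     measure_of UNIV (lambda_system UNIV (Pow UNIV) (hausdorff_outer d)) (hausdorff_outer d)"

lemma hausdorff_weight_empty [simp]: "hausdorff_weight d {} = 0"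
  by (simp add: hausdorff_weight_def)

lemma hausdorff_weight_mono:
  assumes "C \<subseteq> D" "bounded D"
  shows "hausdorff_weight d C \<le> hausdorff_weight d D"
proof (cases "C = {}")
  case False
  have "bounded C" using assms bounded_subset by blast
  then have "(diameter C / 2) ^ d \<le> (diameter D / 2) ^ d"
    using diameter_subset[OF assms] diameter_ge_0 by (intro power_mono) auto
  then show ?thesis
    using False assms(1) by (auto simp: hausdorff_weight_def intro!: ennreal_leI mult_left_mono)
qed simp

lemma hausdorff_pre_antimono:
  assumes "\<delta> \<le> \<delta>'"
  shows "hausdorff_pre d \<delta>' A \<le> hausdorff_pre d \<delta> A"
  unfolding hausdorff_pre_def
  by (rule INF_superset_mono) (use assms in \<open>auto simp: hausdorff_covers_def intro: order_trans\<close>)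

lemma hausdorff_pre_mono:
  assumes "A \<subseteq> B"
  shows "hausdorff_pre d \<delta> A \<le> hausdorff_pre d \<delta> B"
  unfolding hausdorff_pre_def
  by (rule INF_superset_mono) (use assms in \<open>auto simp: hausdorff_covers_def\<close>)

lemma hausdorff_pre_empty:
  assumes "\<delta> \<ge> 0"
  shows "hausdorff_pre d \<delta> {} = 0"
proof -
  have "hausdorff_pre d \<delta> {} \<le> (\<Sum>i::nat. hausdorff_weight d ({} :: 'a set))"
    unfolding hausdorff_pre_def
    by (rule INF_lower2[of "\<lambda>_. {}"]) (use assms in \<open>auto simp: hausdorff_covers_def\<close>)
  then show ?thesis by simp
qed

lemma hausdorff_pre_countably_subadditive:
  "hausdorff_pre d \<delta> (\<Union>i. A i) \<le> (\<Sum>n. hausdorff_pre d \<delta> (A n))"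
proof (rule ennreal_le_epsilon)
  fix e :: real assume e: "0 < e" and fin: "(\<Sum>n. hausdorff_pre d \<delta> (A n)) < top"
  have *: "hausdorff_pre d \<delta> (A n) < hausdorff_pre d \<delta> (A n) + e * (1/2)^Suc n" for n
    using e fin by (auto simp add: less_top dest!: ennreal_suminf_lessD)
  have "\<exists>B. B \<in> hausdorff_covers \<delta> (A n) \<and>
          (\<Sum>i. hausdorff_weight d (B i)) \<le> hausdorff_pre d \<delta> (A n) + e * (1/2)^Suc n" for n
    using *[of n] unfolding hausdorff_pre_def[of d \<delta> "A n"] INF_less_iff
    by (auto intro: less_imp_le)
  then obtain B where B: "\<And>n. B n \<in> hausdorff_covers \<delta> (A n)"
    and Ble: "\<And>n. (\<Sum>i. hausdorff_weight d (B n i)) \<le> hausdorff_pre d \<delta> (A n) + e * (1/2)^Suc n"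
    by metis
  define C where "C = case_prod B o prod_decode"
  have "(\<Union>i. A i) \<subseteq> (\<Union>i. C i)"
  proof
    fix x assume "x \<in> (\<Union>i. A i)"
    then obtain n i where "x \<in> B n i"
      using B by (fastforce simp: hausdorff_covers_def)
    then have "x \<in> C (prod_encode (n, i))" by (simp add: C_def)
    then show "x \<in> (\<Union>i. C i)" by blast
  qed
  then have C: "C \<in> hausdorff_covers \<delta> (\<Union>i. A i)"
    using B by (auto simp: hausdorff_covers_def C_def split: prod.split)
  have "hausdorff_pre d \<delta> (\<Union>i. A i) \<le> (\<Sum>i. hausdorff_weight d (C i))"
    unfolding hausdorff_pre_def by (rule INF_lower[OF C])
  also have "\<dots> = (\<Sum>n. \<Sum>i. hausdorff_weight d (B n i))"
    using suminf_ennreal_2dimen[of "\<lambda>n. \<Sum>i. hausdorff_weight d (B n i)"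
        "\<lambda>p. hausdorff_weight d (case_prod B p)"]
    by (simp add: C_def comp_def)
  also have "\<dots> \<le> (\<Sum>n. hausdorff_pre d \<delta> (A n) + e * (1/2) ^ Suc n)"
    by (intro suminf_le Ble) auto
  also have "\<dots> = (\<Sum>n. hausdorff_pre d \<delta> (A n)) + (\<Sum>n. ennreal e * ennreal ((1/2) ^ Suc n))"
    using e by (subst suminf_add[symmetric])
               (auto simp del: ennreal_suminf_cmult simp add: ennreal_mult[symmetric])
  also have "\<dots> = (\<Sum>n. hausdorff_pre d \<delta> (A n)) + e"
    unfolding ennreal_suminf_cmult
    by (subst suminf_ennreal_eq[OF zero_le_power power_half_series]) auto
  finally show "hausdorff_pre d \<delta> (\<Union>i. A i) \<le> (\<Sum>n. hausdorff_pre d \<delta> (A n)) + e" .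
qed

lemma outer_measure_space_hausdorff:
  "outer_measure_space (Pow UNIV) (hausdorff_outer d :: 'a::metric_space set \<Rightarrow> ennreal)"
  unfolding outer_measure_space_def
proof (intro conjI)
  show "positive (Pow UNIV) (hausdorff_outer d :: 'a set \<Rightarrow> ennreal)"
    by (auto simp: positive_def hausdorff_outer_def hausdorff_pre_empty)
  show "increasing (Pow UNIV) (hausdorff_outer d :: 'a set \<Rightarrow> ennreal)"
    by (auto simp: increasing_def hausdorff_outer_def intro!: SUP_mono' hausdorff_pre_mono)
  show "countably_subadditive (Pow UNIV) (hausdorff_outer d :: 'a set \<Rightarrow> ennreal)"
    unfolding countably_subadditive_def
  proof (intro allI impI)
    fix A :: "nat \<Rightarrow> 'a set"
    show "hausdorff_outer d (\<Union>i. A i) \<le> (\<Sum>i. hausdorff_outer d (A i))"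
      unfolding hausdorff_outer_def[of d "\<Union>i. A i"]
    proof (rule SUP_least)
      fix \<delta> :: real assume \<delta>: "\<delta> \<in> {0<..}"
      have "hausdorff_pre d \<delta> (\<Union>i. A i) \<le> (\<Sum>n. hausdorff_pre d \<delta> (A n))"
        by (rule hausdorff_pre_countably_subadditive)
      also have "\<dots> \<le> (\<Sum>i. hausdorff_outer d (A i))"
        unfolding hausdorff_outer_def by (intro suminf_le SUP_upper \<delta>) auto
      finally show "hausdorff_pre d \<delta> (\<Union>i. A i) \<le> (\<Sum>i. hausdorff_outer d (A i))" .
    qed
  qed
qed

lemma hausdorff_pre_separated:
  assumes "\<delta> < e" and sep: "\<And>a b. a \<in> A \<Longrightarrow> b \<in> B \<Longrightarrow> e \<le> dist a b"
  shows "hausdorff_pre d \<delta> A + hausdorff_pre d \<delta> B \<le> hausdorff_pre d \<delta> (A \<union> B)"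
  unfolding hausdorff_pre_def[of d \<delta> "A \<union> B"]
proof (rule INF_greatest)
  fix C assume C: "C \<in> hausdorff_covers \<delta> (A \<union> B)"
  then have bd: "bounded (C i)" and diam: "diameter (C i) \<le> \<delta>" for i
    by (auto simp: hausdorff_covers_def)
  have cov: "(\<lambda>i. C i \<inter> D) \<in> hausdorff_covers \<delta> D" if "D \<subseteq> A \<union> B" for D
    using C that bd diam diameter_subset[of "C _ \<inter> D" "C _"]
    by (fastforce simp: hausdorff_covers_def intro: order_trans bounded_subset[OF bd])
  have le: "hausdorff_weight d (C i \<inter> A) + hausdorff_weight d (C i \<inter> B) \<le> hausdorff_weight d (C i)"
    for i
  proof -
    have "C i \<inter> A = {} \<or> C i \<inter> B = {}"
      using sep diameter_bounded_bound[OF bd] diam[of i] \<open>\<delta> < e\<close> by (force simp: not_less)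
    then show ?thesis using hausdorff_weight_mono[OF Int_lower1 bd] by auto
  qed
  have "hausdorff_pre d \<delta> A + hausdorff_pre d \<delta> B
      \<le> (\<Sum>i. hausdorff_weight d (C i \<inter> A)) + (\<Sum>i. hausdorff_weight d (C i \<inter> B))"
    unfolding hausdorff_pre_def by (intro add_mono INF_lower cov) auto
  also have "\<dots> = (\<Sum>i. hausdorff_weight d (C i \<inter> A) + hausdorff_weight d (C i \<inter> B))"
    by (intro suminf_add) auto
  also have "\<dots> \<le> (\<Sum>i. hausdorff_weight d (C i))"
    by (intro suminf_le le) auto
  finally show "hausdorff_pre d \<delta> A + hausdorff_pre d \<delta> B \<le> (\<Sum>i. hausdorff_weight d (C i))" .
qed

lemma hausdorff_outer_separated:
  assumes e: "0 < e" and sep: "\<And>a b. a \<in> A \<Longrightarrow> b \<in> B \<Longrightarrow> e \<le> dist a b"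
  shows "hausdorff_outer d A + hausdorff_outer d B \<le> hausdorff_outer d (A \<union> B)"
proof -
  have le: "hausdorff_pre d \<delta> A + hausdorff_pre d \<delta>' B \<le> hausdorff_outer d (A \<union> B)"
    if "\<delta> > 0" "\<delta>' > 0" for \<delta> \<delta>'
  proof -
    define m where "m = min (min \<delta> \<delta>') (e / 2)"
    have m: "m \<le> \<delta>" "m \<le> \<delta>'" "m < e" "0 < m" using that e by (auto simp: m_def)
    have "hausdorff_pre d \<delta> A + hausdorff_pre d \<delta>' B \<le> hausdorff_pre d m A + hausdorff_pre d m B"
      by (intro add_mono hausdorff_pre_antimono m)
    also have "\<dots> \<le> hausdorff_pre d m (A \<union> B)"
      by (rule hausdorff_pre_separated[OF m(3) sep])
    also have "\<dots> \<le> hausdorff_outer d (A \<union> B)"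
      unfolding hausdorff_outer_def by (rule SUP_upper) (use m in auto)
    finally show ?thesis .
  qed
  have "hausdorff_outer d A + hausdorff_outer d B =
      (SUP \<delta>\<in>{0<..}. hausdorff_pre d \<delta> A + hausdorff_outer d B)"
    unfolding hausdorff_outer_def[of d A]
    by (rule ennreal_SUP_add_left[symmetric]) auto
  also have "\<dots> = (SUP \<delta>\<in>{0<..}. SUP \<delta>'\<in>{0<..}. hausdorff_pre d \<delta> A + hausdorff_pre d \<delta>' B)"
    unfolding hausdorff_outer_def[of d B]
    by (intro SUP_cong refl ennreal_SUP_add_right) auto
  also have "\<dots> \<le> hausdorff_outer d (A \<union> B)"
    by (intro SUP_least le) auto
  finally show ?thesis .
qed

text \<open>Caratheodory's criterion: closed sets are measurable for a metric outer measure.\<close>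

lemma closed_in_lambda_system:
  fixes H :: "'a::metric_space set \<Rightarrow> ennreal"
  assumes H: "outer_measure_space (Pow UNIV) H"
    and sepH: "\<And>A B e. 0 < e \<Longrightarrow> (\<And>a b. a \<in> A \<Longrightarrow> b \<in> B \<Longrightarrow> e \<le> dist a b) \<Longrightarrow> H A + H B \<le> H (A \<union> B)"
    and F: "closed F"
  shows "F \<in> lambda_system UNIV (Pow UNIV) H"
proof -
  have H0: "H {} = 0" and mono: "\<And>A B. A \<subseteq> B \<Longrightarrow> H A \<le> H B"
    and cs: "countably_subadditive (Pow UNIV) H"
    using H by (auto simp: outer_measure_space_def positive_def increasing_def)
  have sub: "H (A \<union> B) \<le> H A + H B" for A B
  proof -
    have "H (A \<union> (B - A)) \<le> H A + H (B - A)"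
      by (rule subadditiveD[OF ring_of_sets.countably_subadditive_subadditive[OF ring_of_sets_Pow]])
         (use cs H0 in \<open>auto simp: positive_def simp del: Pow_UNIV\<close>)
    also have "\<dots> \<le> H A + H B" by (intro add_mono mono) auto
    finally show ?thesis by simp
  qed
  have csub: "H (\<Union>i. A i) \<le> (\<Sum>i. H (A i))" for A :: "nat \<Rightarrow> 'a set"
  proof -
    have "H (\<Union>i. A i) = H (\<Union>i. disjointed A i)" by (simp add: UN_disjointed_eq)
    also have "\<dots> \<le> (\<Sum>i. H (disjointed A i))"
      using cs disjoint_family_disjointed[of A] by (auto simp: countably_subadditive_def)
    also have "\<dots> \<le> (\<Sum>i. H (A i))" by (intro suminf_le mono disjointed_subset) auto
    finally show ?thesis .
  qed
  have main: "H (T \<inter> F) + H (T - F) \<le> H T" if ne: "F \<noteq> {}" and fin: "H T < top" for T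
  proof -
    define r where "r k = {x \<in> T. 1 / (real k + 2) \<le> infdist x F \<and> infdist x F < 1 / (real k + 1)}"
      for k :: nat
    define A where "A n = {x \<in> T. 1 / (real n + 1) \<le> infdist x F}" for n :: nat
    have par: "(\<Sum>i<N. H (r (2 * i + p))) \<le> H (\<Union>i<N. r (2 * i + p))" for N p :: nat
    proof (induction N)
      case (Suc N)
      define e where "e = 1 / (real (2 * N + p)) - 1 / (real (2 * N + p) + 1)"
      have "H (\<Union>i<N. r (2 * i + p)) + H (r (2 * N + p)) \<le> H ((\<Union>i<N. r (2 * i + p)) \<union> r (2 * N + p))"
      proof (cases "N = 0")
        case False
        then have "0 < real (2 * N + p)" by simp
        then have "1 / (real (2 * N + p) + 1) < 1 / real (2 * N + p)"
          by (intro divide_strict_left_mono) auto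
        then have "e > 0" by (simp add: e_def)
        then show ?thesis
        proof (rule sepH)
          fix a b assume "a \<in> (\<Union>i<N. r (2 * i + p))" and b: "b \<in> r (2 * N + p)"
          then obtain i where i: "i < N" "a \<in> r (2 * i + p)" by auto
          have "1 / real (2 * N + p) \<le> 1 / (real (2 * i + p) + 2)"
            using i(1) by (intro divide_left_mono) auto
          also have "\<dots> \<le> infdist a F" using i(2) by (auto simp: r_def)
          finally have "1 / real (2 * N + p) \<le> infdist a F" .
          moreover have "infdist b F < 1 / (real (2 * N + p) + 1)" using b by (auto simp: r_def)
          moreover have "infdist a F \<le> infdist b F + dist a b" by (rule infdist_triangle)
          ultimately show "e \<le> dist a b" unfolding e_def by linarith
        qed
      qed (simp add: H0)
      moreover have "(\<Union>i<Suc N. r (2 * i + p)) = (\<Union>i<N. r (2 * i + p)) \<union> r (2 * N + p)"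
        by (auto simp: lessThan_Suc)
      ultimately show ?case
        using order_trans[OF add_right_mono[OF Suc.IH, of "H (r (2 * N + p))"]] by simp
    qed simp
    have par_le: "(\<Sum>i<N. H (r (2 * i + p))) \<le> H T" for N p :: nat
      by (rule order_trans[OF par mono]) (auto simp: r_def)
    have dbl: "(\<Sum>k<2 * N. H (r k)) = (\<Sum>i<N. H (r (2 * i + 0))) + (\<Sum>i<N. H (r (2 * i + 1)))" for N
      by (induction N) (auto simp: algebra_simps)
    have "(\<Sum>k<N. H (r k)) \<le> H T + H T" for N
    proof -
      have "(\<Sum>k<N. H (r k)) \<le> (\<Sum>k<2 * N. H (r k))" by (intro sum_mono2) auto
      also have "\<dots> \<le> H T + H T" unfolding dbl by (intro add_mono par_le)
      finally show ?thesis .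
    qed
    then have S_le: "(\<Sum>k. H (r k)) \<le> H T + H T"
      by (intro suminf_le_const) auto
    define S where "S = (\<Sum>k. H (r k))"
    have Sfin: "S < top" unfolding S_def by (rule le_less_trans[OF S_le]) (use fin in simp)
    have T_A: "T - F \<subseteq> A n \<union> (\<Union>k. r (k + n))" for n
    proof
      fix x assume x: "x \<in> T - F"
      have pos: "0 < infdist x F"
        using x F ne by (simp add: infdist_pos_not_in_closed)
      show "x \<in> A n \<union> (\<Union>k. r (k + n))"
      proof (cases "1 / (real n + 1) \<le> infdist x F")
        case False
        define m where "m = (LEAST m. 1 / (real m + 1) \<le> infdist x F)"
        obtain j :: nat where "1 / (real j + 1) < infdist x F"
          using reals_Archimedean[OF pos] by (auto simp: inverse_eq_divide add.commute)
        then have m: "1 / (real m + 1) \<le> infdist x F"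
          unfolding m_def by (rule LeastI[of _ j, OF less_imp_le])
        have "n < m"
        proof (rule ccontr)
          assume "\<not> n < m"
          then have "1 / (real n + 1) \<le> 1 / (real m + 1)" by (intro divide_left_mono) auto
          with m False show False by linarith
        qed
        then obtain k where k: "m = Suc (k + n)"
          using less_imp_Suc_add[of n m] by (auto simp: add.commute)
        have "\<not> 1 / (real (k + n) + 1) \<le> infdist x F"
          using not_less_Least[of "k + n" "\<lambda>m. 1 / (real m + 1) \<le> infdist x F", folded m_def] k
          by simp
        then have "x \<in> r (k + n)" using x m k by (simp add: r_def algebra_simps)
        then show ?thesis by blast
      qed (use x in \<open>simp add: A_def\<close>)
    qed
    have step: "H (T \<inter> F) + H (T - F) + (\<Sum>k<n. H (r k)) \<le> H T + S" for n
    proof -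
      have "H (T \<inter> F) + H (A n) \<le> H ((T \<inter> F) \<union> A n)"
      proof (rule sepH)
        show "0 < 1 / (real n + 1)" by simp
        fix a b assume "a \<in> T \<inter> F" "b \<in> A n"
        then show "1 / (real n + 1) \<le> dist a b"
          using infdist_le[of a F b] by (auto simp: A_def dist_commute)
      qed
      also have "\<dots> \<le> H T" by (rule mono) (auto simp: A_def)
      finally have 1: "H (T \<inter> F) + H (A n) \<le> H T" .
      have "H (T - F) \<le> H (A n) + H (\<Union>k. r (k + n))"
        by (rule order_trans[OF mono[OF T_A] sub])
      also have "\<dots> \<le> H (A n) + (\<Sum>k. H (r (k + n)))" by (intro add_mono csub) auto
      finally have "H (T \<inter> F) + H (T - F) \<le> H (T \<inter> F) + (H (A n) + (\<Sum>k. H (r (k + n))))"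
        by (rule add_left_mono)
      also have "\<dots> \<le> H T + (\<Sum>k. H (r (k + n)))"
        using add_right_mono[OF 1] by (simp add: add.assoc)
      finally have "H (T \<inter> F) + H (T - F) + (\<Sum>k<n. H (r k))
          \<le> H T + ((\<Sum>k. H (r (k + n))) + (\<Sum>k<n. H (r k)))"
        by (subst add.assoc[of "H T", symmetric]) (rule add_right_mono)
      also have "(\<Sum>k. H (r (k + n))) + (\<Sum>k<n. H (r k)) = S"
        unfolding S_def by (rule suminf_offset[symmetric]) (rule summableI)
      finally show ?thesis .
    qed
    have "H (T \<inter> F) + H (T - F) + S = (SUP n. H (T \<inter> F) + H (T - F) + (\<Sum>k<n. H (r k)))"
      unfolding S_def suminf_eq_SUP by (rule ennreal_SUP_add_right) simp
    also have "\<dots> \<le> H T + S" by (intro SUP_least step)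
    finally have "S + (H (T \<inter> F) + H (T - F)) \<le> S + H T" by (simp add: add.commute)
    then show ?thesis using Sfin by (auto simp: ennreal_add_left_cancel_le)
  qed
  have "H (T \<inter> F) + H (T - F) = H T" for T
  proof (rule antisym)
    show "H (T \<inter> F) + H (T - F) \<le> H T"
    proof (cases "F = {} \<or> H T = top")
      case False
      then show ?thesis using main by (simp add: less_top)
    qed (auto simp: H0)
    show "H T \<le> H (T \<inter> F) + H (T - F)"
      using sub[of "T \<inter> F" "T - F"] by (simp add: Int_Diff_Un)
  qed
  then show ?thesis
    by (simp add: algebra.lambda_system_eq[OF algebra_Pow] del: Pow_UNIV)
qed

lemma measure_space_hausdorff:
  "measure_space UNIV (lambda_system UNIV (Pow UNIV) (hausdorff_outer d :: 'a::metric_space set \<Rightarrow> ennreal))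
     (hausdorff_outer d)"
  by (rule sigma_algebra.caratheodory_lemma[OF sigma_algebra_Pow outer_measure_space_hausdorff])

lemma space_hausdorff [simp]: "space (hausdorff_measure d) = UNIV"
  by (simp add: hausdorff_measure_def space_measure_of_conv)

lemma sets_hausdorff:
  "sets (hausdorff_measure d :: 'a::metric_space measure) =
     lambda_system UNIV (Pow UNIV) (hausdorff_outer d)"
proof -
  have "sigma_algebra UNIV (lambda_system UNIV (Pow UNIV) (hausdorff_outer d :: 'a set \<Rightarrow> ennreal))"
    using measure_space_hausdorff by (auto simp: measure_space_def)
  then show ?thesis
    by (simp add: hausdorff_measure_def sigma_algebra.sigma_sets_eq)
qed

lemma emeasure_hausdorff:
  fixes A :: "'a::metric_space set"
  assumes "A \<in> sets (hausdorff_measure d)"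
  shows "emeasure (hausdorff_measure d) A = hausdorff_outer d A"
  unfolding hausdorff_measure_def
  by (rule emeasure_measure_of_sigma)
     (use assms measure_space_hausdorff[of d, where 'a='a] in
        \<open>auto simp: measure_space_def sets_hausdorff\<close>)

lemma borel_sets_hausdorff:
  "sets borel \<subseteq> sets (hausdorff_measure d :: 'a::metric_space measure)"
proof -
  have "{S :: 'a set. closed S} \<subseteq> sets (hausdorff_measure d)"
    unfolding sets_hausdorff
    by (blast intro: closed_in_lambda_system outer_measure_space_hausdorff hausdorff_outer_separated)
  then have "sigma_sets UNIV {S :: 'a set. closed S} \<subseteq> sets (hausdorff_measure d)"
    using sets.sigma_sets_subset[of "{S :: 'a set. closed S}" "hausdorff_measure d"] by simp
  then show ?thesis by (simp add: borel_eq_closed)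
qed


section \<open>Convex bodies and illumination surface bodies\<close>

definition convex_body :: "'a::euclidean_space set \<Rightarrow> bool" where
  "convex_body K \<longleftrightarrow> compact K \<and> convex K \<and> interior K \<noteq> {}"

definition centroid :: "'a::euclidean_space set \<Rightarrow> 'a" where
  "centroid K = (1 / measure lborel K) *\<^sub>R (LINT x:K|lborel. x)"

text \<open>
  The surface area measure on the boundary of \<open>K\<close> is the \<open>(n - 1)\<close>-dimensional Hausdorff measure;
  \<open>frontier K\<close> is the underlying space, so functions only matter through their values there.
\<close>

definition surface_area_measure :: "'a::euclidean_space set \<Rightarrow> 'a measure" where
  "surface_area_measure K = restrict_space (hausdorff_measure (DIM('a) - 1)) (frontier K)"

definition weighted_surface_measure ::
    "'a::euclidean_space set \<Rightarrow> ('a \<Rightarrow> real) \<Rightarrow> 'a measure" where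
  "weighted_surface_measure K f = density (surface_area_measure K) (\<lambda>x. ennreal (f x))"

definition illumination_surface_body ::
    "'a::euclidean_space set \<Rightarrow> ('a \<Rightarrow> real) \<Rightarrow> real \<Rightarrow> 'a set" where
  "illumination_surface_body K f s =
     {x. emeasure (weighted_surface_measure K f)
           (frontier K \<inter> closure (convex hull (insert x K) - K)) \<le> ennreal s}"

end

theory Submission
  imports Defs
begin

text \<open>
  A separating hyperplane shows that the centroid \<open>0\<close> lies in \<open>K\<close>. Hence every \<open>y \<in> [0, x]\<close>
  lies in \<open>[x, K]\<close>, so \<open>[y, K] \<subseteq> [x, K]\<close> and (ii) follows from monotonicity of the measure.
\<close>

text \<open>Needed to cancel the factor \<open>1 / measure lborel K\<close> in
  \<open>centroid\<close>, which would be the default value 0 for a null set. An interior ball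
  already has positive volume.\<close>

lemma convex_body_measure_pos:
  assumes "convex_body K"
  shows "0 < measure lborel K"
proof -
  have "compact K" "interior K \<noteq> {}" using assms by (auto simp: convex_body_def)
  then obtain x e where "0 < e" "ball x e \<subseteq> K"
    by (metis all_not_in_conv mem_interior)
  have "0 < measure lborel (ball x e)"
    using \<open>0 < e\<close> content_ball_pos[of e x] by simp
  also have "\<dots> \<le> measure lborel K"
    using \<open>ball x e \<subseteq> K\<close> \<open>compact K\<close>
    by (intro measure_mono_fmeasurable fmeasurable_compact) (auto intro: borel_open)
  finally show ?thesis .
qed

text \<open>Averaging a linear inequality over \<open>K\<close> transfers it to the centroid, so no
  hyperplane can strictly separate the centroid from \<open>K\<close>.\<close>

lemma centroid_mem_convex_body:
  assumes K: "convex_body K"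
  shows "centroid K \<in> K"
proof (rule ccontr)
  assume out: "centroid K \<notin> K"
  have cpt: "compact K" and "convex K" using K by (auto simp: convex_body_def)
  obtain a b where a: "a \<bullet> centroid K < b" and b: "\<And>x. x \<in> K \<Longrightarrow> b < a \<bullet> x"
    using separating_hyperplane_closed_point[OF \<open>convex K\<close> compact_imp_closed[OF cpt] out] by auto
  have pos: "0 < measure lborel K" by (rule convex_body_measure_pos[OF K])
  have int: "set_integrable lborel K (\<lambda>x. x)" and intb: "set_integrable lborel K (\<lambda>x. b)"
    and inta: "set_integrable lborel K (\<lambda>x. a \<bullet> x)"
    unfolding set_integrable_def
    by (intro borel_integrable_compact[OF cpt] continuous_intros)+
  have "b * measure lborel K = (LINT x:K|lborel. b)"
    using cpt by (simp add: set_lebesgue_integral_def borel_compact)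
  \<comment> \<open>Weakening \<open>b < a \<bullet> x\<close> to a non-strict bound is harmless:
    the contradiction comes from the strict inequality
    \<open>a \<bullet> centroid K < b\<close>.\<close>
  also have "\<dots> \<le> (LINT x:K|lborel. a \<bullet> x)"
    using b by (intro set_integral_mono intb inta less_imp_le)
  also have "\<dots> = a \<bullet> (LINT x:K|lborel. x)"
    using integral_inner_right[of a lborel "\<lambda>x. indicator K x *\<^sub>R x"] int
    unfolding set_integrable_def set_lebesgue_integral_def by simp
  also have "(LINT x:K|lborel. x) = measure lborel K *\<^sub>R centroid K"
    using pos by (simp add: centroid_def)
  finally have "b \<le> a \<bullet> centroid K"
    using pos by (simp add: mult.commute)
  with a show False by simp
qed

text \<open>Pointwise this is the fact that a value in \<open>ennreal\<close> is at most
  \<open>s\<close> iff it is at most \<open>s + \<delta>\<close> for every positive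
  \<open>\<delta>\<close>; no continuity of the measure is involved.\<close>

lemma illumination_surface_body_Inter:
  assumes "0 \<le> s"
  shows "illumination_surface_body K f s = (\<Inter>\<delta>\<in>{0<..}. illumination_surface_body K f (s + \<delta>))"
proof -
  have "v \<le> ennreal s \<longleftrightarrow> (\<forall>\<delta>>0. v \<le> ennreal (s + \<delta>))" for v
  proof (intro iffI allI impI)
    fix \<delta> :: real
    assume "v \<le> ennreal s" "0 < \<delta>"
    then show "v \<le> ennreal (s + \<delta>)"
      by (elim order_trans) (simp add: ennreal_leI)
  next
    assume *: "\<forall>\<delta>>0. v \<le> ennreal (s + \<delta>)"
    show "v \<le> ennreal s"
    proof (rule ennreal_le_epsilon)
      fix e :: real
      assume "0 < e"
      \<comment> \<open>Since \<open>ennreal\<close> truncates negative reals to 0, splitting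
        \<open>ennreal (s + e)\<close> into a sum relies on \<open>0 \<le> s\<close>.\<close>
      then show "v \<le> ennreal s + ennreal e"
        using * \<open>0 \<le> s\<close> by (simp flip: ennreal_plus)
    qed
  qed
  then show ?thesis by (auto simp: illumination_surface_body_def)
qed

text \<open>Supplies the measurability side condition for monotonicity of \<open>emeasure\<close>,
  which is 0 on non-measurable sets.\<close>

lemma closed_inter_frontier_in_sets:
  fixes K C :: "'a::euclidean_space set"
  assumes "closed C"
  shows "frontier K \<inter> C \<in> sets (weighted_surface_measure K f)"
proof -
  have "C \<in> sets (hausdorff_measure (DIM('a) - 1))"
    using borel_closed[OF assms] borel_sets_hausdorff by blast
  then show ?thesis
    by (simp add: weighted_surface_measure_def surface_area_measure_def sets_restrict_space)
qed

text \<open>Any point of \<open>K\<close> can serve as the centre, because \<open>c\<close> and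
  \<open>x\<close> both lie in the convex set [x, K].\<close>

lemma illumination_surface_body_star_convex:
  assumes "c \<in> K" and x: "x \<in> illumination_surface_body K f s"
  shows "closed_segment c x \<subseteq> illumination_surface_body K f s"
proof
  fix y assume y: "y \<in> closed_segment c x"
  let ?H = "\<lambda>z. convex hull (insert z K)"
  have "closed_segment c x \<subseteq> ?H x"
    using assms(1) by (intro closed_segment_subset) (auto intro: hull_inc)
  then have "insert y K \<subseteq> ?H x" using y by (auto intro: hull_inc)
  then have "?H y \<subseteq> ?H x" by (simp add: hull_minimal)
  then have "closure (?H y - K) \<subseteq> closure (?H x - K)"
    by (intro closure_mono) auto
  then have "emeasure (weighted_surface_measure K f) (frontier K \<inter> closure (?H y - K))
      \<le> emeasure (weighted_surface_measure K f) (frontier K \<inter> closure (?H x - K))"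
    \<comment> \<open>Only the larger set has to be measurable; the closure in the definition makes
      it relatively closed in \<open>frontier K\<close>.\<close>
    by (intro emeasure_mono closed_inter_frontier_in_sets) auto
  then show "y \<in> illumination_surface_body K f s"
    using x by (auto simp: illumination_surface_body_def)
qed

theorem lemma3p1:
  fixes K :: "(real ^ 'n) set" and f :: "real ^ 'n \<Rightarrow> real" and s :: real
  assumes "convex_body K"
    and "centroid K = 0"
    and "s \<ge> 0"
    and "\<And>x. x \<in> frontier K \<Longrightarrow> f x \<ge> 0"
    and "integrable (surface_area_measure K) f"
  shows "illumination_surface_body K f s
           = (\<Inter>\<delta>\<in>{0<..}. illumination_surface_body K f (s + \<delta>))
       \<and> (\<forall>x\<in>illumination_surface_body K f s.
             closed_segment 0 x \<subseteq> illumination_surface_body K f s)"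
proof -
  have "0 \<in> K" using centroid_mem_convex_body[OF assms(1)] assms(2) by simp
  then show ?thesis
    using illumination_surface_body_Inter[OF assms(3)] illumination_surface_body_star_convex
    by (intro conjI ballI)
qed

end
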